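(* Let $C \in \mathbb{R}^{n\times n}$ be a matrix with nonnegative entries, let $X^0 \in \mathring{\mathbb{X}}$, and let $(\alpha_k)_{k \ge 0}$ be a sequence of positive learning rates such that $$\lim_{k\to\infty}\alpha_k = 0,\qquad \sum_{k=0}^\infty \alpha_k = +\infty,\qquad \sum_{k=0}^\infty \alpha_k\,(\exp\{\alpha_k\}-1) < \infty .$$ Let $X^{k+1} = T_{\alpha_k}(X^k)$ for $k\ge 0$ be the Hedge iterates, and let $\bar X^K = \frac{1}{A_K}\sum_{k=0}^K \alpha_k X^k$ with $A_K=\sum_{k=0}^K\alpha_k$. Then the limit set of the sequence $\{\bar X^K\}_{K=0}^\infty$ is connected.
   Context: $C\in\mathbb{R}^{n\times n}$ is the payoff matrix of the symmetric bimatrix game $(C,C^T)$. $\mathbb{X}=\{X\in\mathbb{R}^n: X\ge 0,\ \sum_i X(i)=1\}$ is the simplex of mixed strategies and $\mathring{\mathbb{X}}$ is its relative interior (all coordinates positive). For $\alpha>0$ the Hedge map is $T_\alpha(X)(i) = X(i)\,\dfrac{\exp\{\alpha (CX)_i\}}{\sum_{j=1}^n X(j)\exp\{\alpha (CX)_j\}}$, $i=1,\dots,n$, where $(CX)_i$ is the $i$-th coordinate of $CX$. The limit set of a sequence is the set of its limit points (limits of convergent subsequences). *)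

theory Defs
  imports "HOL-Analysis.Analysis"
begin

definition mixed_strategies :: "(real ^ 'n) set" where
  "mixed_strategies = {X. (\<forall>i. 0 \<le> X $ i) \<and> (\<Sum>i\<in>UNIV. X $ i) = 1}"

definition interior_mixed_strategies :: "(real ^ 'n) set" where
  "interior_mixed_strategies = rel_interior mixed_strategies"

definition hedge_map :: "real ^ 'n ^ 'n \<Rightarrow> real \<Rightarrow> real ^ 'n \<Rightarrow> real ^ 'n" where
  "hedge_map C a X =
    (\<chi> i. X $ i * (exp (a * (C *v X) $ i) / (\<Sum>j\<in>UNIV. X $ j * exp (a * (C *v X) $ j))))"

primrec hedge_iterate ::
  "real ^ 'n ^ 'n \<Rightarrow> (nat \<Rightarrow> real) \<Rightarrow> real ^ 'n \<Rightarrow> nat \<Rightarrow> real ^ 'n" where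
  "hedge_iterate C \<alpha> X0 0 = X0"
| "hedge_iterate C \<alpha> X0 (Suc k) = hedge_map C (\<alpha> k) (hedge_iterate C \<alpha> X0 k)"

definition weighted_average :: "(nat \<Rightarrow> real) \<Rightarrow> (nat \<Rightarrow> real ^ 'n) \<Rightarrow> nat \<Rightarrow> real ^ 'n" where
  "weighted_average \<alpha> X K = (1 / (\<Sum>k\<le>K. \<alpha> k)) *\<^sub>R (\<Sum>k\<le>K. \<alpha> k *\<^sub>R X k)"

(* Not the library's islimpt applied to the range: a value attained infinitely often by the
   sequence counts as a limit point here even if it is isolated in the range. *)
definition limit_set :: "(nat \<Rightarrow> 'a::topological_space) \<Rightarrow> 'a set" where
  "limit_set f = {l. \<exists>r. strict_mono r \<and> (f \<circ> r) \<longlonglongrightarrow> l}"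

lemma mixed_strategies_eq_convex_hull:
  "(mixed_strategies :: (real ^ 'n) set) = convex hull (range (\<lambda>i. axis i 1))"
proof -
  have ax: "(\<Sum>i\<in>UNIV. u i *\<^sub>R axis i 1) = (\<chi> i. u i)" for u :: "'n \<Rightarrow> real"
    by (simp add: vec_eq_iff axis_def if_distrib cong: if_cong)
  show ?thesis
  proof (intro equalityI subsetI)
    fix X :: "real ^ 'n" assume X: "X \<in> mixed_strategies"
    have "(\<Sum>i\<in>UNIV. X $ i *\<^sub>R axis i (1::real)) \<in> convex hull (range (\<lambda>i. axis i 1))"
      by (rule convex_sum) (use X in \<open>auto simp: mixed_strategies_def hull_inc\<close>)
    then show "X \<in> convex hull (range (\<lambda>i. axis i 1))"
      by (simp add: ax)
  next
    fix X :: "real ^ 'n" assume X: "X \<in> convex hull (range (\<lambda>i. axis i 1))"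
    have "convex (mixed_strategies :: (real ^ 'n) set)"
      by (auto simp: convex_def mixed_strategies_def sum.distrib simp flip: sum_distrib_left)
    moreover have "range (\<lambda>i. axis i 1) \<subseteq> (mixed_strategies :: (real ^ 'n) set)"
      by (auto simp: mixed_strategies_def axis_def)
    ultimately show "X \<in> mixed_strategies"
      using X hull_minimal[of _ mixed_strategies convex] by blast
  qed
qed

lemma interior_mixed_strategies_iff:
  "X \<in> interior_mixed_strategies \<longleftrightarrow> (\<forall>i. 0 < X $ i) \<and> (\<Sum>i\<in>UNIV. X $ i) = 1"
  for X :: "real ^ 'n"
proof -
  let ?S = "range (\<lambda>i::'n. axis i (1::real))"
  have ax: "(\<Sum>i\<in>UNIV. u i *\<^sub>R axis i 1) = (\<chi> i. u i)" for u :: "'n \<Rightarrow> real"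
    by (simp add: vec_eq_iff axis_def if_distrib cong: if_cong)
  have inj: "inj (\<lambda>i::'n. axis i (1::real))"
    by (auto simp: inj_on_def axis_eq_axis)
  have S: "?S = (Basis :: (real ^ 'n) set)"
    by (auto simp: Basis_vec_def)
  have "\<not> affine_dependent ?S"
    unfolding S using independent_Basis affine_dependent_imp_dependent by blast
  then have *: "interior_mixed_strategies =
      {y. \<exists>u. (\<forall>x\<in>?S. 0 < u x) \<and> sum u ?S = 1 \<and> (\<Sum>x\<in>?S. u x *\<^sub>R x) = y}"
    unfolding interior_mixed_strategies_def mixed_strategies_eq_convex_hull
    by (rule rel_interior_convex_hull_explicit)
  show ?thesis
  proof
    assume "X \<in> interior_mixed_strategies"
    then obtain u where u: "\<forall>x\<in>?S. 0 < u x" "sum u ?S = 1" "(\<Sum>x\<in>?S. u x *\<^sub>R x) = X"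
      unfolding * by blast
    then have "X = (\<chi> i. u (axis i 1))"
      by (simp add: sum.reindex[OF inj] ax)
    then show "(\<forall>i. 0 < X $ i) \<and> (\<Sum>i\<in>UNIV. X $ i) = 1"
      using u by (simp add: sum.reindex[OF inj])
  next
    assume X: "(\<forall>i. 0 < X $ i) \<and> (\<Sum>i\<in>UNIV. X $ i) = 1"
    define u where "u x = X $ (inv (\<lambda>i. axis i (1::real)) x)" for x
    have "u (axis i 1) = X $ i" for i
      by (simp add: u_def inv_f_f[OF inj])
    then show "X \<in> interior_mixed_strategies"
      unfolding * using X
      by (auto intro!: exI[of _ u] simp: sum.reindex[OF inj] ax)
  qed
qed

end

(* The averages stay bounded, and since each step moves the average by at most a constant times
   alpha_{K+1}, consecutive averages become arbitrarily close. For such a sequence the limit set is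
   closed, and if it split into two closed pieces then the sequence, passing from one to the other
   infinitely often in ever smaller steps, would accumulate strictly between them. *)

theory Submission
  imports Defs
begin

text \<open>This epsilon form lets the later arguments work with indices beyond any given bound
  instead of with subsequences.\<close>

lemma limit_set_iff:
  fixes f :: "nat \<Rightarrow> 'a::metric_space"
  shows "l \<in> limit_set f \<longleftrightarrow> (\<forall>e>0. \<forall>N. \<exists>n\<ge>N. dist (f n) l < e)"
proof
  assume "l \<in> limit_set f"
  then obtain r where r: "strict_mono r" "(f \<circ> r) \<longlonglongrightarrow> l"
    by (auto simp: limit_set_def)
  show "\<forall>e>0. \<forall>N. \<exists>n\<ge>N. dist (f n) l < e"
  proof (intro allI impI)
    fix e :: real and N :: nat
    assume "e > 0"
    then obtain M where M: "\<And>n. n \<ge> M \<Longrightarrow> dist (f (r n)) l < e"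
      using r(2) by (auto simp: lim_sequentially)
    have "r (max M N) \<ge> N"
      using seq_suble[OF r(1), of "max M N"] by simp
    then show "\<exists>n\<ge>N. dist (f n) l < e"
      using M[of "max M N"] by auto
  qed
next
  assume *: "\<forall>e>0. \<forall>N. \<exists>n\<ge>N. dist (f n) l < e"
  \<comment> \<open>Indices are picked one after another: the first conjunct, a bound of 1/(k+1),
    forces convergence, and the second makes the choice a subsequence.\<close>
  have "\<exists>r. \<forall>k. dist (f (r k)) l < inverse (real (Suc k)) \<and> r k < r (Suc k)"
  proof (rule dependent_nat_choice)
    show "\<exists>n. dist (f n) l < inverse (real (Suc 0))"
      using *[rule_format, of 1 0] by auto
    show "\<exists>m. dist (f m) l < inverse (real (Suc (Suc k))) \<and> n < m" for n k
      using *[rule_format, of "inverse (real (Suc (Suc k)))" "Suc n"]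
      by (auto simp: Suc_le_eq simp del: of_nat_Suc)
  qed
  then obtain r where r: "\<And>k. dist (f (r k)) l < inverse (real (Suc k))" "\<And>k. r k < r (Suc k)"
    by blast
  have "(f \<circ> r) \<longlonglongrightarrow> l"
  proof (rule metric_tendsto_imp_tendsto[OF LIMSEQ_inverse_real_of_nat])
    show "\<forall>\<^sub>F k in sequentially. dist ((f \<circ> r) k) l \<le> dist (inverse (real (Suc k))) 0"
      using r(1) by (auto intro!: always_eventually less_imp_le simp del: of_nat_Suc)
  qed
  then show "l \<in> limit_set f"
    using r(2) by (auto simp: limit_set_def strict_mono_Suc_iff)
qed

text \<open>Limit points are exactly the points in the closure of every tail, so the set is an
  intersection of closed sets.\<close>

lemma closed_limit_set:
  fixes f :: "nat \<Rightarrow> 'a::metric_space"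
  shows "closed (limit_set f)"
proof -
  have "limit_set f = (\<Inter>N. closure (f ` {N..}))"
    by (simp add: set_eq_iff limit_set_iff closure_approachable Bex_def) blast
  then show ?thesis
    by auto
qed

lemma limit_set_subset_closure: "limit_set f \<subseteq> closure (range f)"
  for f :: "nat \<Rightarrow> 'a::metric_space"
  by (simp add: subset_iff limit_set_iff closure_approachable) blast

text \<open>Bolzano-Weierstrass, applied to the subsequence of visits to \<open>S\<close>;
  closedness keeps the limit in \<open>S\<close>.\<close>

lemma limit_set_meets_closed:
  fixes f :: "nat \<Rightarrow> 'a::heine_borel"
  assumes "bounded (range f)" and "closed S" and freq: "\<And>N. \<exists>n\<ge>N. f n \<in> S"
  shows "limit_set f \<inter> S \<noteq> {}"
proof -
  have "infinite {n. f n \<in> S}"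
    using freq by (auto simp: infinite_nat_iff_unbounded_le)
  then obtain r :: "nat \<Rightarrow> nat" where r: "strict_mono r" "\<And>n. f (r n) \<in> S"
    using infinite_enumerate by blast
  have "bounded (range (f \<circ> r))"
    using assms(1) by (rule bounded_subset) auto
  then obtain l s where s: "strict_mono s" "(f \<circ> r \<circ> s) \<longlonglongrightarrow> l"
    using bounded_imp_convergent_subsequence by blast
  have "l \<in> S"
    using closed_sequentially[OF assms(2) _ s(2)] r(2) by simp
  moreover have "l \<in> limit_set f"
    unfolding limit_set_def
    using s strict_mono_o[OF r(1) s(1)] by (auto simp: comp_assoc)
  ultimately show ?thesis
    by blast
qed

lemma connected_limit_set:
  fixes f :: "nat \<Rightarrow> 'a::heine_borel"
  assumes bdd: "bounded (range f)"
    and step: "(\<lambda>n. dist (f (Suc n)) (f n)) \<longlonglongrightarrow> 0"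
  shows "connected (limit_set f)"
proof (rule ccontr)
  assume "\<not> connected (limit_set f)"
  then obtain A B where AB: "closed A" "closed B" "A \<noteq> {}" "B \<noteq> {}"
      "A \<union> B = limit_set f" "A \<inter> B = {}"
    unfolding connected_closed_set[OF closed_limit_set] by metis
  have "A \<subseteq> closure (range f)"
    using limit_set_subset_closure[of f] AB(5) by blast
  then have "bounded A"
    by (rule bounded_subset[OF bounded_closure[OF bdd]])
  then have "compact A"
    using AB(1) by (simp add: compact_eq_bounded_closed)
  \<comment> \<open>Disjoint closed sets may have distance zero; compactness of \<open>A\<close>,
    inherited from the bounded range, gives a positive gap \<open>d\<close>.\<close>
  then obtain d where d: "d > 0" "\<And>x y. x \<in> A \<Longrightarrow> y \<in> B \<Longrightarrow> d \<le> dist x y"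
    using separate_compact_closed[OF _ AB(2,6)] by blast
  \<comment> \<open>\<open>infdist\<close> to the empty set is 0 by default, so \<open>A\<close>
    being nonempty matters here.\<close>
  have infdist_B: "infdist y A \<ge> d" if "y \<in> B" for y
    unfolding infdist_notempty[OF AB(3)]
    using AB(3) d(2)[OF _ that] by (intro cINF_greatest) (auto simp: dist_commute)
  define g where "g n = infdist (f n) A" for n
  \<comment> \<open>A closed shell around \<open>A\<close> that misses both \<open>A\<close>
    (distance 0) and \<open>B\<close> (distance at least \<open>d\<close>). Its width d/3 is chosen
    so that steps shorter than d/3 cannot jump across it.\<close>
  let ?S = "{x. infdist x A \<in> {d/3..2*d/3}}"
  have "\<exists>n\<ge>N. f n \<in> ?S" for N
  proof -
    obtain M where M: "\<And>n. n \<ge> M \<Longrightarrow> dist (f (Suc n)) (f n) < d/3"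
      using step[THEN LIMSEQ_D, of "d/3"] d(1) by auto
    obtain a where a: "a \<in> A" using AB(3) by blast
    then have "a \<in> limit_set f" using AB(5) by blast
    then obtain n1 where n1: "n1 \<ge> max N M" "dist (f n1) a < d/3"
      using d(1) by (auto simp: limit_set_iff dest!: spec[of _ "d/3"] spec[of _ "max N M"])
    have g1: "g n1 < d/3"
      using infdist_le[OF a, of "f n1"] n1(2) by (simp add: g_def)
    obtain b where b: "b \<in> B" using AB(4) by blast
    then have "b \<in> limit_set f" using AB(5) by blast
    then obtain n2 where n2: "n2 \<ge> n1" "dist (f n2) b < d/3"
      using d(1) by (auto simp: limit_set_iff dest!: spec[of _ "d/3"] spec[of _ n1])
    \<comment> \<open>\<open>b\<close> is at least \<open>d\<close> away from \<open>A\<close> and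
      \<open>f n2\<close> is within d/3 of \<open>b\<close>, which even leaves 2d/3.\<close>
    have g2: "g n2 \<ge> d/3"
      using infdist_triangle[of b A "f n2"] infdist_B[OF b] n2(2) d(1)
      by (simp add: g_def dist_commute)
    \<comment> \<open>The first index from \<open>n1\<close> on at which the sequence has left the
      d/3-neighbourhood of \<open>A\<close>. Its predecessor is still inside, so one short step
      keeps \<open>g m\<close> below 2d/3.\<close>
    define m where "m = (LEAST m. m \<ge> n1 \<and> g m \<ge> d/3)"
    have m: "m \<ge> n1" "g m \<ge> d/3"
      using LeastI[of "\<lambda>m. m \<ge> n1 \<and> g m \<ge> d/3" n2] n2(1) g2 by (auto simp: m_def)
    have "m \<noteq> n1"
      using m(2) g1 by auto
    then obtain k where k: "m = Suc k" "k \<ge> n1"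
      using m(1) by (cases m) auto
    have "g k < d/3"
      using not_less_Least[of k "\<lambda>m. m \<ge> n1 \<and> g m \<ge> d/3"] k unfolding m_def[symmetric] by simp
    moreover have "g m \<le> g k + dist (f m) (f k)"
      unfolding g_def by (rule infdist_triangle)
    moreover have "dist (f m) (f k) < d/3"
      using M[of k] k n1(1) by simp
    ultimately have "f m \<in> ?S"
      using m(2) by (simp add: g_def)
    then show ?thesis
      using m(1) n1(1) by (intro exI[of _ m]) auto
  qed
  moreover have "closed ?S"
    using closed_vimage[OF closed_atLeastAtMost, of "\<lambda>x. infdist x A" "d/3" "2*d/3"]
    by (simp add: vimage_def continuous_on_infdist)
  ultimately obtain l where l: "l \<in> limit_set f" "infdist l A \<in> {d/3..2*d/3}"
    using limit_set_meets_closed[OF bdd] by blast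
  from l(1) AB(5) consider "l \<in> A" | "l \<in> B" by blast
  then show False
    using l(2) infdist_B[of l] d(1) by cases auto
qed

text \<open>With partial sums A_K, the new average is the convex combination of the old average and
  the new point with weights A_K/A_{K+1} and \<alpha>_{K+1}/A_{K+1}; subtracting the old average
  leaves a multiple of the gap.\<close>

lemma weighted_average_Suc:
  assumes pos: "\<And>k. 0 < \<alpha> k"
  shows "weighted_average \<alpha> X (Suc K) - weighted_average \<alpha> X K =
    (\<alpha> (Suc K) / (\<Sum>k\<le>Suc K. \<alpha> k)) *\<^sub>R (X (Suc K) - weighted_average \<alpha> X K)"
proof -
  define s where "s = (\<Sum>k\<le>Suc K. \<alpha> k)"
  have s_K: "(\<Sum>k\<le>K. \<alpha> k) = s - \<alpha> (Suc K)"
    by (simp add: s_def)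
  have "s > 0" and "(\<Sum>k\<le>K. \<alpha> k) > 0"
    unfolding s_def by (rule sum_pos; use pos in auto)+
  moreover define w where "w = weighted_average \<alpha> X K"
  ultimately have "(\<Sum>k\<le>K. \<alpha> k *\<^sub>R X k) = (s - \<alpha> (Suc K)) *\<^sub>R w"
    by (simp add: weighted_average_def s_K)
  then have avg: "weighted_average \<alpha> X (Suc K) =
      (1 / s) *\<^sub>R ((s - \<alpha> (Suc K)) *\<^sub>R w + \<alpha> (Suc K) *\<^sub>R X (Suc K))"
    unfolding weighted_average_def s_def[symmetric] by simp
  show ?thesis
    unfolding avg s_def[symmetric] w_def[symmetric]
    using \<open>s > 0\<close> by (simp add: vec_eq_iff field_simps)
qed

lemma norm_weighted_average_le:
  assumes pos: "\<And>k. 0 < \<alpha> k" and X: "\<And>k. norm (X k) \<le> b"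
  shows "norm (weighted_average \<alpha> X K) \<le> b"
proof -
  define s where "s = (\<Sum>k\<le>K. \<alpha> k)"
  have "s > 0"
    unfolding s_def by (rule sum_pos) (use pos in auto)
  have "norm (\<Sum>k\<le>K. \<alpha> k *\<^sub>R X k) \<le> (\<Sum>k\<le>K. \<alpha> k * b)"
    using pos X by (intro sum_norm_le) (simp add: less_imp_le mult_left_mono abs_of_pos)
  then have "norm (\<Sum>k\<le>K. \<alpha> k *\<^sub>R X k) \<le> s * b"
    by (simp add: s_def sum_distrib_right)
  then show ?thesis
    using \<open>s > 0\<close> by (simp add: weighted_average_def field_simps flip: s_def)
qed

lemma dist_weighted_average_Suc_tendsto_0:
  assumes pos: "\<And>k. 0 < \<alpha> k" and X: "\<And>k. norm (X k) \<le> b" and "\<alpha> \<longlonglongrightarrow> 0"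
  shows "(\<lambda>K. dist (weighted_average \<alpha> X (Suc K)) (weighted_average \<alpha> X K)) \<longlonglongrightarrow> 0"
proof (rule tendsto_sandwich[OF always_eventually always_eventually tendsto_const])
  have "dist (weighted_average \<alpha> X (Suc K)) (weighted_average \<alpha> X K)
      \<le> \<alpha> (Suc K) / \<alpha> 0 * (2 * b)" for K
  proof -
    \<comment> \<open>The fixed lower bound \<open>\<alpha> 0\<close> on the partial sums makes the
      increment a constant multiple of \<open>\<alpha> (Suc K)\<close>. The factor
      \<open>2 * b\<close> arises because the new point and the old average both lie in the ball of
      radius \<open>b\<close>.\<close>
    have "\<alpha> 0 \<le> (\<Sum>k\<le>Suc K. \<alpha> k)"
      by (rule member_le_sum) (use pos in \<open>auto intro: less_imp_le\<close>)
    then have "\<alpha> (Suc K) / (\<Sum>k\<le>Suc K. \<alpha> k) \<le> \<alpha> (Suc K) / \<alpha> 0"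
      using pos[of 0] pos[of "Suc K"] by (intro divide_left_mono mult_pos_pos) auto
    moreover have "norm (X (Suc K) - weighted_average \<alpha> X K) \<le> 2 * b"
      using norm_triangle_ineq4[of "X (Suc K)" "weighted_average \<alpha> X K"]
        X[of "Suc K"] norm_weighted_average_le[of \<alpha> X, OF pos X, of K] by linarith
    moreover have "0 \<le> (\<Sum>k\<le>Suc K. \<alpha> k)"
      by (rule sum_nonneg) (use pos in \<open>auto intro: less_imp_le\<close>)
    ultimately show ?thesis
      unfolding dist_norm weighted_average_Suc[of \<alpha>, OF pos] norm_scaleR
      using pos[of 0] pos[of "Suc K"]
      by (intro mult_mono) (simp_all del: sum.atMost_Suc)
  qed
  then show "\<forall>K. dist (weighted_average \<alpha> X (Suc K)) (weighted_average \<alpha> X K)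
      \<le> \<alpha> (Suc K) / \<alpha> 0 * (2 * b)"
    by blast
  have "(\<lambda>K. \<alpha> (Suc K) / \<alpha> 0 * (2 * b)) \<longlonglongrightarrow> 0 / \<alpha> 0 * (2 * b)"
    using pos[of 0] by (intro tendsto_intros LIMSEQ_Suc assms) auto
  then show "(\<lambda>K. \<alpha> (Suc K) / \<alpha> 0 * (2 * b)) \<longlonglongrightarrow> 0"
    by simp
qed auto

lemma hedge_map_in_mixed_strategies:
  assumes "X \<in> mixed_strategies"
  shows "hedge_map C a X \<in> mixed_strategies"
proof -
  let ?Z = "\<Sum>j\<in>UNIV. X $ j * exp (a * (C *v X) $ j)"
  have nonneg: "\<And>i. 0 \<le> X $ i" and sum: "(\<Sum>i\<in>UNIV. X $ i) = 1"
    using assms by (auto simp: mixed_strategies_def)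
  \<comment> \<open>Coordinates may vanish on the closed simplex, so a positive one is extracted
    from the total mass 1 to keep the normalizing denominator \<open>?Z\<close> away from 0.\<close>
  have "\<exists>i. X $ i \<noteq> 0"
    using sum by (metis sum.neutral zero_neq_one)
  then obtain i where "X $ i > 0"
    using nonneg by (metis less_le)
  then have "?Z > 0"
    using nonneg by (intro sum_pos2[of _ i]) auto
  then show ?thesis
    using nonneg
    by (auto simp: mixed_strategies_def hedge_map_def simp flip: sum_divide_distrib)
qed

lemma hedge_iterate_in_mixed_strategies:
  "X0 \<in> mixed_strategies \<Longrightarrow> hedge_iterate C \<alpha> X0 k \<in> mixed_strategies"
  by (induction k) (auto intro: hedge_map_in_mixed_strategies)

text \<open>The l1 norm equals 1 on the simplex and dominates the Euclidean norm. This gives the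
  iterates their uniform bound.\<close>

lemma norm_mixed_strategies_le: "X \<in> mixed_strategies \<Longrightarrow> norm X \<le> 1"
  using norm_le_l1_cart[of X] by (simp add: mixed_strategies_def)

theorem theorem3:
  fixes C :: "real ^ 'n ^ 'n"
    and X0 :: "real ^ 'n"
    and \<alpha> :: "nat \<Rightarrow> real"
  assumes "\<forall>i j. 0 \<le> C $ i $ j"
    and "X0 \<in> interior_mixed_strategies"
    and "\<forall>k. 0 < \<alpha> k"
    and "\<alpha> \<longlonglongrightarrow> 0"
    and "filterlim (\<lambda>K. \<Sum>k\<le>K. \<alpha> k) at_top sequentially"
    and "summable (\<lambda>k. \<alpha> k * (exp (\<alpha> k) - 1))"
  shows "connected (limit_set (weighted_average \<alpha> (hedge_iterate C \<alpha> X0)))"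
proof (rule connected_limit_set)
  have pos: "\<And>k. 0 < \<alpha> k"
    using assms(3) by blast
  \<comment> \<open>The relative interior lies in the simplex, which the Hedge map preserves, so all
    iterates are bounded by \<open>b = 1\<close>.\<close>
  have "X0 \<in> mixed_strategies"
    using assms(2) rel_interior_subset by (auto simp: interior_mixed_strategies_def)
  then have X: "norm (hedge_iterate C \<alpha> X0 k) \<le> 1" for k
    by (intro norm_mixed_strategies_le hedge_iterate_in_mixed_strategies)
  show "bounded (range (weighted_average \<alpha> (hedge_iterate C \<alpha> X0)))"
    unfolding bounded_iff
    using norm_weighted_average_le[of \<alpha> "hedge_iterate C \<alpha> X0", OF pos X] by blast
  show "(\<lambda>K. dist (weighted_average \<alpha> (hedge_iterate C \<alpha> X0) (Suc K))
      (weighted_average \<alpha> (hedge_iterate C \<alpha> X0) K)) \<longlonglongrightarrow> 0"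
    using dist_weighted_average_Suc_tendsto_0[of \<alpha> "hedge_iterate C \<alpha> X0", OF pos X assms(4)] .
qed

end
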